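(* Let $r\ge 3$ be an integer and let $G$ be a $d$-regular, $K_{1,r}$-free graph on $n$ vertices. (i) If $r\equiv 0 \pmod 2$, then $\alpha_{\mathrm{od}}(G)\le \frac{r-1}{d+r-1}\,n$. (ii) If $r\equiv 1 \pmod 2$, then $\alpha_{\mathrm{od}}(G)\le \frac{r-2}{d+r-2}\,n$.
   Context: Graphs are finite and simple; $N(v)$ is the open neighborhood of $v$. An odd independent set in $G=(V,E)$ is an independent set $S\subseteq V$ such that for every $v\in V\setminus S$, either $N(v)\cap S=\varnothing$ or $|N(v)\cap S|$ is odd. $\alpha_{\mathrm{od}}(G)$ denotes the largest cardinality of an odd independent set in $G$. A graph is $K_{1,r}$-free if it contains no induced subgraph isomorphic to $K_{1,r}$. *)

theory Defs
  imports Complex_Main "Graph_Theory.Kuratowski"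
begin

text \<open>
  A finite simple graph is represented as in the Graph_Theory library: a digraph satisfying
  \<^const>\<open>graph\<close>, i.e. finite, symmetric, loop-free and without parallel arcs, so that each
  undirected edge uv appears as the pair of arcs (u,v) and (v,u). The definitions below are
  intended for such graphs only.
\<close>

definition neighborhood :: "('a, 'b) pre_digraph \<Rightarrow> 'a \<Rightarrow> 'a set" where
  "neighborhood G v = {u \<in> verts G. v \<rightarrow>\<^bsub>G\<^esub> u}"

definition regular :: "nat \<Rightarrow> ('a, 'b) pre_digraph \<Rightarrow> bool" where
  "regular d G \<longleftrightarrow> (\<forall>v \<in> verts G. card (neighborhood G v) = d)"

text \<open>
  The predicate \<open>K\<^bsub>1,r\<^esub>\<close> holds of every graph of the shape of the star with r leaves, whatever
  its vertices are named, so no separate isomorphism is needed.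
\<close>

definition star_free :: "nat \<Rightarrow> ('a, 'b) pre_digraph \<Rightarrow> bool" where
  "star_free r G \<longleftrightarrow> \<not> (\<exists>H. induced_subgraph H G \<and> K\<^bsub>1,r\<^esub> H)"

definition independent_set :: "('a, 'b) pre_digraph \<Rightarrow> 'a set \<Rightarrow> bool" where
  "independent_set G S \<longleftrightarrow> S \<subseteq> verts G \<and> (\<forall>u \<in> S. \<forall>v \<in> S. \<not> u \<rightarrow>\<^bsub>G\<^esub> v)"

definition odd_independent_set :: "('a, 'b) pre_digraph \<Rightarrow> 'a set \<Rightarrow> bool" where
  "odd_independent_set G S \<longleftrightarrow> independent_set G S \<and>
     (\<forall>v \<in> verts G - S. neighborhood G v \<inter> S = {} \<or> odd (card (neighborhood G v \<inter> S)))"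

definition odd_independence_number :: "('a, 'b) pre_digraph \<Rightarrow> nat" where
  "odd_independence_number G = Max {card S | S. odd_independent_set G S}"

end

theory Submission
  imports Defs
begin

text \<open>
  Let \<open>S\<close> be an odd independent set. The neighbours of a vertex \<open>v\<close> inside \<open>S\<close> are pairwise
  non-adjacent, so together with \<open>v\<close> they induce a star; in a \<open>K\<^bsub>1,r\<^esub>\<close>-free graph there are
  at most \<open>r - 1\<close> of them (\<open>star_free_card_less\<close>). If \<open>r\<close> is odd and \<open>v \<notin> S\<close>, the value \<open>r - 1\<close> is even and
  positive, hence excluded by the parity condition, and at most \<open>r - 2\<close> neighbours remain. Call the
  resulting bound \<open>k\<close>. Since \<open>S\<close> is independent and the graph is \<open>d\<close>-regular, exactly
  \<open>d \<cdot> |S|\<close> edges join \<open>S\<close> to its complement, and counting them from the other side gives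
  \<open>d \<cdot> |S| \<le> k \<cdot> (n - |S|)\<close> (\<open>independent_set_double_counting\<close>). Solving for \<open>|S|\<close>
  yields both bounds.
\<close>

lemma independent_set_subset:
  "independent_set G S \<Longrightarrow> T \<subseteq> S \<Longrightarrow> independent_set G T"
  unfolding independent_set_def by blast

lemma star_free_card_less:
  assumes "graph G" and "star_free r G" and v: "v \<in> verts G"
    and indep: "independent_set G T" and T: "T \<subseteq> neighborhood G v"
  shows "card T < r"
proof (rule ccontr)
  assume "\<not> card T < r"
  then obtain U where U: "U \<subseteq> T" "card U = r"
    using obtain_subset_with_card_n[of r T] by (auto simp: not_less)
  interpret graph G by fact
  have sym: "x \<rightarrow>\<^bsub>G\<^esub> y \<Longrightarrow> y \<rightarrow>\<^bsub>G\<^esub> x" for x y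
    using arcs_ends_symmetric[OF sym_arcs] .
  have irrefl: "\<not> v \<rightarrow>\<^bsub>G\<^esub> v"
    using no_loops by (auto simp: arcs_ends_conv)
  have nbr: "v \<rightarrow>\<^bsub>G\<^esub> u" if "u \<in> U" for u
    using that U(1) T by (auto simp: neighborhood_def)
  have nonadj: "\<not> u \<rightarrow>\<^bsub>G\<^esub> w" if "u \<in> U" "w \<in> U" for u w
    using that U(1) indep by (auto simp: independent_set_def)
  have "{v} \<union> U \<subseteq> verts G"
    using v U(1) T by (auto simp: neighborhood_def)
  then have induced: "induced_subgraph (G \<restriction> ({v} \<union> U)) G"
    by (rule induced_induce)
  have "arcs_ends (G \<restriction> ({v} \<union> U))
      = {(x, y). x \<rightarrow>\<^bsub>G\<^esub> y \<and> x \<in> {v} \<union> U \<and> y \<in> {v} \<union> U}"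
    unfolding arcs_ends_conv induce_subgraph_arcs induce_subgraph_tail induce_subgraph_head
    by auto
  also have "\<dots> = {v} \<times> U \<union> U \<times> {v}"
    using irrefl nbr nonadj sym by auto
  finally have arcs: "arcs_ends (G \<restriction> ({v} \<union> U)) = {v} \<times> U \<union> U \<times> {v}" .
  have disjoint: "{v} \<inter> U = {}"
    using irrefl nbr by blast
  have "graph (G \<restriction> ({v} \<union> U))"
    using digraphI_induced[OF induced] induced_graph_imp_symmetric[OF sym_arcs induced]
    by (rule digraph.graphI)
  moreover have "verts (G \<restriction> ({v} \<union> U)) = {v} \<union> U" and "card {v} = 1"
    by simp_all
  ultimately have "K\<^bsub>1,r\<^esub> (G \<restriction> ({v} \<union> U))"
    unfolding complete_bipartite_digraph_def using arcs disjoint U(2) by blast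
  then show False
    using induced \<open>star_free r G\<close> unfolding star_free_def by blast
qed

text \<open>The product form avoids both truncated subtraction and division.\<close>

lemma independent_set_double_counting:
  assumes "graph G" and "regular d G" and indep: "independent_set G S"
    and bound: "\<And>v. v \<in> verts G - S \<Longrightarrow> card (neighborhood G v \<inter> S) \<le> k"
  shows "(d + k) * card S \<le> k * card (verts G)"
proof -
  interpret graph G by fact
  have S: "S \<subseteq> verts G"
    using indep by (simp add: independent_set_def)
  then have "finite S"
    using finite_verts finite_subset by blast
  have sym: "x \<rightarrow>\<^bsub>G\<^esub> y \<longleftrightarrow> y \<rightarrow>\<^bsub>G\<^esub> x" for x y
    using arcs_ends_symmetric[OF sym_arcs] by blast
  have from_S: "card {v \<in> verts G - S. s \<rightarrow>\<^bsub>G\<^esub> v} = d" if "s \<in> S" for s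
  proof -
    have "{v \<in> verts G - S. s \<rightarrow>\<^bsub>G\<^esub> v} = neighborhood G s"
      using that indep by (auto simp: neighborhood_def independent_set_def)
    then show ?thesis
      using that S \<open>regular d G\<close> by (auto simp: regular_def)
  qed
  have to_S: "{s \<in> S. s \<rightarrow>\<^bsub>G\<^esub> v} = neighborhood G v \<inter> S" for v
    using S sym by (auto simp: neighborhood_def)
  have "d * card S = (\<Sum>s\<in>S. d)"
    by simp
  also have "\<dots> = (\<Sum>s\<in>S. card {v \<in> verts G - S. s \<rightarrow>\<^bsub>G\<^esub> v})"
    by (intro sum.cong refl from_S[symmetric])
  also have "\<dots> = (\<Sum>v\<in>verts G - S. card (neighborhood G v \<inter> S))"
    using \<open>finite S\<close> by (intro sum_multicount_gen) (auto simp: to_S)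
  also have "\<dots> \<le> (\<Sum>v\<in>verts G - S. k)"
    by (intro sum_mono bound)
  also have "\<dots> = k * card (verts G - S)"
    by simp
  finally have "d * card S \<le> k * card (verts G - S)" .
  moreover have "card (verts G) = card (verts G - S) + card S"
    using S \<open>finite S\<close> by (simp add: card_Diff_subset card_mono)
  ultimately show ?thesis
    by (simp add: algebra_simps)
qed

lemma odd_independence_number_attained:
  assumes "finite (verts G)"
  obtains S where "odd_independent_set G S" and "card S = odd_independence_number G"
proof -
  let ?C = "{card S | S. odd_independent_set G S}"
  have "?C \<subseteq> {..card (verts G)}"
    using assms by (auto simp: odd_independent_set_def independent_set_def intro: card_mono)
  then have "finite ?C"
    using finite_subset by blast
  moreover have "odd_independent_set G {}"
    by (simp add: odd_independent_set_def independent_set_def)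
  ultimately have "Max ?C \<in> ?C"
    by (intro Max_in) auto
  then show thesis
    using that unfolding odd_independence_number_def by fastforce
qed

theorem proposition1:
  fixes G :: "('a, 'b) pre_digraph" and r d n :: nat
  assumes "r \<ge> 3"
    and "graph G"
    and "regular d G"
    and "star_free r G"
    and "card (verts G) = n"
  shows "(even r \<longrightarrow>
            real (odd_independence_number G) \<le> (real r - 1) / (real d + real r - 1) * real n) \<and>
         (odd r \<longrightarrow>
            real (odd_independence_number G) \<le> (real r - 2) / (real d + real r - 2) * real n)"
proof -
  interpret graph G by fact
  obtain S where S: "odd_independent_set G S" and card_S: "card S = odd_independence_number G"
    using odd_independence_number_attained[OF finite_verts] .
  have indep: "independent_set G S"
    using S by (simp add: odd_independent_set_def)
  have less: "card (neighborhood G v \<inter> S) < r" if "v \<in> verts G" for v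
    using star_free_card_less[OF \<open>graph G\<close> \<open>star_free r G\<close> that
        independent_set_subset[OF indep Int_lower2] Int_lower1] .
  have solve: "real (odd_independence_number G) \<le> real k / (real d + real k) * real n"
    if k: "k > 0" "\<And>v. v \<in> verts G - S \<Longrightarrow> card (neighborhood G v \<inter> S) \<le> k" for k
  proof -
    have "(d + k) * card S \<le> k * n"
      using independent_set_double_counting[OF \<open>graph G\<close> \<open>regular d G\<close> indep k(2)] assms(5) by simp
    then have "real ((d + k) * card S) \<le> real (k * n)"
      by (rule of_nat_mono)
    then show ?thesis
      using k(1) by (simp add: card_S[symmetric] pos_le_divide_eq algebra_simps)
  qed
  show ?thesis
  proof (intro conjI impI)
    have "card (neighborhood G v \<inter> S) \<le> r - 1" if "v \<in> verts G - S" for v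
      using less[of v] that by auto
    then show "real (odd_independence_number G) \<le> (real r - 1) / (real d + real r - 1) * real n"
      using solve[of "r - 1"] \<open>r \<ge> 3\<close> by (simp add: algebra_simps)
  next
    assume "odd r"
    have "card (neighborhood G v \<inter> S) \<le> r - 2" if v: "v \<in> verts G - S" for v
    proof -
      have "neighborhood G v \<inter> S = {} \<or> odd (card (neighborhood G v \<inter> S))"
        using S v by (simp add: odd_independent_set_def)
      then have "card (neighborhood G v \<inter> S) \<noteq> r - 1"
        using \<open>odd r\<close> \<open>r \<ge> 3\<close> by auto
      then show ?thesis
        using less[of v] v by auto
    qed
    then show "real (odd_independence_number G) \<le> (real r - 2) / (real d + real r - 2) * real n"
      using solve[of "r - 2"] \<open>r \<ge> 3\<close> by (simp add: algebra_simps)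
  qed
qed

end
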